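(* Let $c\in(0,1]$ and let $$f(x)=\begin{cases}-ac, & -1\le x<-c,\\ ax, & -c\le x\le c,\\ ac, & c<x\le 1,\end{cases}$$ where $a$ is a real parameter. Let $\{X_n^\varepsilon\}_{n\ge 0}$ be the process defined by $X_0^\varepsilon=0$ and $X_{n+1}^\varepsilon=f(X_n^\varepsilon)+\varepsilon\xi_{n+1}$, and let $\tau=\min\{n\ge 1:|X_n^\varepsilon|\ge 1\}$. Then $$\limsup_{\varepsilon\to 0}\varepsilon^2\log E\tau\le\begin{cases}\frac12\left((1-ac)^2+(1-a^2)c^2\right), & c\le a,\\ \frac12(1-a^2), & c\ge a.\end{cases}$$
   Context: Here $\varepsilon>0$ is a small parameter tending to $0$, $\{\xi_n\}_{n\ge 1}$ is an i.i.d. sequence of standard normal random variables, and $E\tau$ is the expected exit time of the process from the interval $(-1,1)$. The function $f$ is specified on $[-1,1]$ and is taken to be continuous on $\mathbb{R}$; only its values on $[-1,1]$ affect the exit time $\tau$.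
   Formalization: The parameter a is restricted to -c ≤ a ≤ 1; for every other real a the stated inequality is false (e.g. a = 2, c = 1 gives the bound -1, although Eτ ≥ 1; a = -0.9, c = 0.1 also fails). *)

theory Defs
  imports "HOL-Probability.Probability"
begin

primrec perturbed_orbit ::
  "(real \<Rightarrow> real) \<Rightarrow> (nat \<Rightarrow> 'a \<Rightarrow> real) \<Rightarrow> real \<Rightarrow> nat \<Rightarrow> 'a \<Rightarrow> real"
where
  "perturbed_orbit f \<xi> \<epsilon> 0 \<omega> = 0"
| "perturbed_orbit f \<xi> \<epsilon> (Suc n) \<omega> = f (perturbed_orbit f \<xi> \<epsilon> n \<omega>) + \<epsilon> * \<xi> (Suc n) \<omega>"

text \<open>The infimum of the empty set in \<^typ>\<open>enat\<close> is \<open>\<infinity>\<close>, so paths that never leave have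
  infinite exit time and the expectation below is not silently truncated.\<close>

definition exit_time ::
  "(real \<Rightarrow> real) \<Rightarrow> (nat \<Rightarrow> 'a \<Rightarrow> real) \<Rightarrow> real \<Rightarrow> 'a \<Rightarrow> enat"
where
  "exit_time f \<xi> \<epsilon> \<omega> = Inf {enat n | n. n \<ge> 1 \<and> \<bar>perturbed_orbit f \<xi> \<epsilon> n \<omega>\<bar> \<ge> 1}"

definition expected_exit_time ::
  "'a measure \<Rightarrow> (real \<Rightarrow> real) \<Rightarrow> (nat \<Rightarrow> 'a \<Rightarrow> real) \<Rightarrow> real \<Rightarrow> ennreal"
where
  "expected_exit_time M f \<xi> \<epsilon> = (\<integral>\<^sup>+ \<omega>. ennreal_of_enat (exit_time f \<xi> \<epsilon> \<omega>) \<partial>M)"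

definition ext_ln :: "ennreal \<Rightarrow> ereal" where
  "ext_ln x = (if x = \<infinity> then \<infinity> else if x = 0 then -\<infinity> else ereal (ln (enn2real x)))"

end

(* After replacing X_n by sgn(a)^n X_n one may assume a >= 0. Then f coincides on [-1,1] with the
   monotone map x |-> a max(-c, min(c, x)), so a noise sequence that dominates a given control
   u_1, ..., u_N termwise keeps the orbit above the controlled one. One fixed control thus drives
   every starting point past 1: disjoint blocks of length N succeed independently with probability
   at least p, and E tau <= N / p without any Markov property. Gaussian tails give
   -eps^2 log p -> (1/2) sum u_k^2. A control that relaxes from -c towards 0, grows
   geometrically from near 0 to a level y <= c and then jumps to 1 has cost close to
   (1/2) (y^2 (1 - a^2) + (1 - a y)^2); the levels y = c and y = a give the two bounds. *)
theory Submission
  imports Defs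
begin

section \<open>The saturated linear map and its controlled orbits\<close>

text \<open>Writing the three-piece map as a clamp gives a function on the whole line, monotone for
  \<open>b \<ge> 0\<close>, so states outside the interval need no case of their own.\<close>

definition saturate :: "real \<Rightarrow> real \<Rightarrow> real \<Rightarrow> real" where
  "saturate b c x = b * max (- c) (min c x)"

definition steer :: "real \<Rightarrow> real \<Rightarrow> real \<Rightarrow> real list \<Rightarrow> real" where
  "steer b c = foldl (\<lambda>x u. saturate b c x + u)"

lemma steer_Nil [simp]: "steer b c x [] = x"
  and steer_Cons [simp]: "steer b c x (u # us) = steer b c (saturate b c x + u) us"
  and steer_append [simp]: "steer b c x (us @ vs) = steer b c (steer b c x us) vs"
  by (simp_all add: steer_def)

lemma saturate_mono: "0 \<le> b \<Longrightarrow> x \<le> y \<Longrightarrow> saturate b c x \<le> saturate b c y"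
  unfolding saturate_def by (intro mult_left_mono) auto

lemma saturate_eq: "\<bar>x\<bar> \<le> c \<Longrightarrow> saturate b c x = b * x"
  by (auto simp: saturate_def abs_le_iff max_def min_def)

text \<open>One step without control brings every starting point to at least \<open>- c\<close>,
  which is why controls need only be designed from \<open>- c\<close>.\<close>

lemma saturate_ge:
  assumes "0 \<le> b" "b \<le> 1" "0 \<le> c"
  shows "- c \<le> saturate b c x"
proof -
  have "b * (- c) \<le> saturate b c x"
    unfolding saturate_def using assms by (intro mult_left_mono) auto
  moreover have "b * c \<le> 1 * c" using assms by (intro mult_right_mono)
  ultimately show ?thesis by simp
qed

lemma steer_mono: "0 \<le> b \<Longrightarrow> x \<le> y \<Longrightarrow> steer b c x us \<le> steer b c y us"
  by (induction us arbitrary: x y) (auto simp: saturate_mono)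

section \<open>Cheap controls: relaxation, growth and final jump\<close>

text \<open>Inside the linear zone, decay at rate \<open>r\<close> instead of the natural rate
  \<open>b\<close> takes the push \<open>c * r ^ n * (b - r)\<close>, nonnegative since
  \<open>r \<le> b\<close>. The squares form a geometric series, and for \<open>r = b\<close>
  relaxation is free.\<close>

lemma steer_relax:
  assumes "0 \<le> r" "r \<le> b" "r < 1" "0 \<le> c"
  shows "\<exists>us. (\<forall>u\<in>set us. 0 \<le> u) \<and> steer b c (- c) us = - c * r ^ n \<and>
           (\<Sum>u\<leftarrow>us. u\<^sup>2) = c\<^sup>2 * (b - r)\<^sup>2 / (1 - r\<^sup>2) * (1 - r ^ (2 * n))"
proof (induction n)
  case 0
  show ?case by (rule exI[of _ "[]"]) simp
next
  case (Suc n)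
  then obtain us where us: "\<forall>u\<in>set us. 0 \<le> u" "steer b c (- c) us = - c * r ^ n"
    "(\<Sum>u\<leftarrow>us. u\<^sup>2) = c\<^sup>2 * (b - r)\<^sup>2 / (1 - r\<^sup>2) * (1 - r ^ (2 * n))" by blast
  have "r ^ n \<le> 1" using assms by (simp add: power_le_one)
  then have "c * r ^ n \<le> c * 1" using assms by (intro mult_left_mono)
  then have sat: "saturate b c (- c * r ^ n) = b * (- c * r ^ n)"
    using assms by (intro saturate_eq) (auto simp: abs_mult)
  have r2: "1 - r\<^sup>2 \<noteq> 0"
    using assms by (simp add: power2_eq_1_iff)
  have "(c * r ^ n * (b - r))\<^sup>2 = c\<^sup>2 * (b - r)\<^sup>2 * r ^ (2 * n)"
    by (simp add: power_mult_distrib power_mult [symmetric] mult.commute)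
  also have "\<dots> = c\<^sup>2 * (b - r)\<^sup>2 / (1 - r\<^sup>2) * (r ^ (2 * n) * (1 - r\<^sup>2))"
    using r2 by simp
  also have "r ^ (2 * n) * (1 - r\<^sup>2) = r ^ (2 * n) - r ^ (2 * Suc n)"
    by (simp add: algebra_simps power2_eq_square)
  finally have *: "(c * r ^ n * (b - r))\<^sup>2 =
    c\<^sup>2 * (b - r)\<^sup>2 / (1 - r\<^sup>2) * (r ^ (2 * n) - r ^ (2 * Suc n))" .
  have step: "saturate b c (- c * r ^ n) + c * r ^ n * (b - r) = - c * r ^ Suc n"
    unfolding sat by (simp add: algebra_simps)
  let ?us = "us @ [c * r ^ n * (b - r)]"
  have "\<forall>u\<in>set ?us. 0 \<le> u" using us(1) assms by simp
  moreover have "steer b c (- c) ?us = - c * r ^ Suc n"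
    by (simp only: steer_append steer_Cons steer_Nil us(2) step)
  moreover have "(\<Sum>u\<leftarrow>?us. u\<^sup>2) =
      c\<^sup>2 * (b - r)\<^sup>2 / (1 - r\<^sup>2) * (1 - r ^ (2 * n)) + (c * r ^ n * (b - r))\<^sup>2"
    using us(3) by simp
  then have "(\<Sum>u\<leftarrow>?us. u\<^sup>2) = c\<^sup>2 * (b - r)\<^sup>2 / (1 - r\<^sup>2) * (1 - r ^ (2 * Suc n))"
    unfolding * distrib_left[symmetric] by simp
  ultimately show ?case by blast
qed

text \<open>The path is the time reversal of geometric decay: raising \<open>y * r ^ Suc n\<close>
  to \<open>y * r ^ n\<close> takes \<open>y * r ^ n * (1 - b * r)\<close>, and the squares again
  sum geometrically. For \<open>r = b\<close> the prefactor becomes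
  \<open>y\<^sup>2 * (1 - b\<^sup>2)\<close>.\<close>

lemma steer_grow:
  assumes "0 \<le> r" "r \<le> b" "b \<le> 1" "r < 1" "0 \<le> y" "y \<le> c"
  shows "\<exists>us. (\<forall>u\<in>set us. 0 \<le> u) \<and> steer b c (y * r ^ n) us = y \<and>
           (\<Sum>u\<leftarrow>us. u\<^sup>2) = y\<^sup>2 * (1 - b * r)\<^sup>2 / (1 - r\<^sup>2) * (1 - r ^ (2 * n))"
proof (induction n)
  case 0
  show ?case by (rule exI[of _ "[]"]) simp
next
  case (Suc n)
  then obtain us where us: "\<forall>u\<in>set us. 0 \<le> u" "steer b c (y * r ^ n) us = y"
    "(\<Sum>u\<leftarrow>us. u\<^sup>2) = y\<^sup>2 * (1 - b * r)\<^sup>2 / (1 - r\<^sup>2) * (1 - r ^ (2 * n))" by blast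
  have "r ^ Suc n \<le> 1" using assms by (intro power_le_one) auto
  then have "y * r ^ Suc n \<le> y * 1" using assms by (intro mult_left_mono)
  then have sat: "saturate b c (y * r ^ Suc n) = b * (y * r ^ Suc n)"
    using assms by (intro saturate_eq) (auto simp: abs_mult)
  have r2: "1 - r\<^sup>2 \<noteq> 0"
    using assms by (simp add: power2_eq_1_iff)
  have "(y * r ^ n * (1 - b * r))\<^sup>2 = y\<^sup>2 * (1 - b * r)\<^sup>2 * r ^ (2 * n)"
    by (simp add: power_mult_distrib power_mult [symmetric] mult.commute)
  also have "\<dots> = y\<^sup>2 * (1 - b * r)\<^sup>2 / (1 - r\<^sup>2) * (r ^ (2 * n) * (1 - r\<^sup>2))"
    using r2 by simp
  also have "r ^ (2 * n) * (1 - r\<^sup>2) = r ^ (2 * n) - r ^ (2 * Suc n)"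
    by (simp add: algebra_simps power2_eq_square)
  finally have *: "(y * r ^ n * (1 - b * r))\<^sup>2 =
    y\<^sup>2 * (1 - b * r)\<^sup>2 / (1 - r\<^sup>2) * (r ^ (2 * n) - r ^ (2 * Suc n))" .
  have step: "saturate b c (y * r ^ Suc n) + y * r ^ n * (1 - b * r) = y * r ^ n"
    unfolding sat by (simp add: algebra_simps)
  have "b * r \<le> 1" using assms by (intro mult_le_one) auto
  \<comment> \<open>The induction moves the starting point closer to 0, so the new control comes
    first, not last as in relaxation.\<close>
  let ?us = "y * r ^ n * (1 - b * r) # us"
  have "\<forall>u\<in>set ?us. 0 \<le> u" using us(1) assms \<open>b * r \<le> 1\<close> by simp
  moreover have "steer b c (y * r ^ Suc n) ?us = y"
    by (simp only: steer_Cons us(2) step)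
  moreover have "(\<Sum>u\<leftarrow>?us. u\<^sup>2) =
      y\<^sup>2 * (1 - b * r)\<^sup>2 / (1 - r\<^sup>2) * (1 - r ^ (2 * n)) + (y * r ^ n * (1 - b * r))\<^sup>2"
    using us(3) by simp
  then have "(\<Sum>u\<leftarrow>?us. u\<^sup>2) = y\<^sup>2 * (1 - b * r)\<^sup>2 / (1 - r\<^sup>2) * (1 - r ^ (2 * Suc n))"
    unfolding * distrib_left[symmetric] by simp
  ultimately show ?case by blast
qed

text \<open>The rate \<open>r = b\<close> is optimal but must be avoided when \<open>b = 1\<close>, where \<open>1 - r\<^sup>2\<close> vanishes.\<close>
lemma rate_exists:
  fixes b c y \<delta> :: real
  assumes "0 \<le> b" "b \<le> 1" "0 \<le> c" "c \<le> 1" "0 \<le> y" "y \<le> c" "0 < \<delta>"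
  obtains r where "0 \<le> r" "r \<le> b" "r < 1"
    "c\<^sup>2 * (b - r)\<^sup>2 / (1 - r\<^sup>2) + y\<^sup>2 * (1 - b * r)\<^sup>2 / (1 - r\<^sup>2) \<le> y\<^sup>2 * (1 - b\<^sup>2) + \<delta>"
proof (cases "b = 1")
  case False
  then have "b < 1" using assms by simp
  then have "b\<^sup>2 < 1" using assms by (simp add: abs_square_less_1)
  then show ?thesis
    using that[of b] \<open>b < 1\<close> assms by (simp add: power2_eq_square)
next
  case True
  \<comment> \<open>With \<open>b = 1\<close> both terms carry the factor
    \<open>(1 - r) / (1 + r) \<le> 1 - r\<close>, here at most \<open>\<delta> / 2\<close>. As
    \<open>c\<close> and \<open>y\<close> are at most 1, the two together stay below
    \<open>\<delta>\<close>; the maximum with 0 covers large \<open>\<delta>\<close>.\<close>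
  define r where "r = max 0 (1 - \<delta> / 2)"
  have r: "0 \<le> r" "r < 1" "1 - r \<le> \<delta> / 2" using assms by (auto simp: r_def max_def)
  have "(1 - r)\<^sup>2 / (1 - r\<^sup>2) = ((1 - r) * (1 - r)) / ((1 - r) * (1 + r))"
    by (simp add: power2_eq_square algebra_simps)
  also have "\<dots> = (1 - r) / (1 + r)"
    using r by (intro nonzero_mult_divide_mult_cancel_left) simp
  also have "\<dots> \<le> 1 - r" using r by (simp add: divide_simps mult_le_cancel_left1)
  also note r(3)
  finally have q: "(1 - r)\<^sup>2 / (1 - r\<^sup>2) \<le> \<delta> / 2" .
  have q0: "0 \<le> (1 - r)\<^sup>2 / (1 - r\<^sup>2)" using r by (simp add: power_le_one)
  have "c\<^sup>2 * ((1 - r)\<^sup>2 / (1 - r\<^sup>2)) \<le> 1 * ((1 - r)\<^sup>2 / (1 - r\<^sup>2))"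
    "y\<^sup>2 * ((1 - r)\<^sup>2 / (1 - r\<^sup>2)) \<le> 1 * ((1 - r)\<^sup>2 / (1 - r\<^sup>2))"
    using assms q0 by (intro mult_right_mono power_le_one; linarith)+
  then show ?thesis using that[of r] r q True by simp
qed

lemma control_exists:
  fixes b c \<delta> :: real
  assumes b: "0 \<le> b" "b \<le> 1" and c: "0 < c" "c \<le> 1" and \<delta>: "0 < \<delta>"
    and y: "0 \<le> y" "y \<le> c"
  obtains us where "us \<noteq> []" "\<And>u. u \<in> set us \<Longrightarrow> 0 \<le> u" "\<And>x. 1 \<le> steer b c x us"
    "(\<Sum>u\<leftarrow>us. u\<^sup>2) \<le> 1 - 2 * b * y + y\<^sup>2 + \<delta>"
proof -
  obtain r where r: "0 \<le> r" "r \<le> b" "r < 1" and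
    cost: "c\<^sup>2 * (b - r)\<^sup>2 / (1 - r\<^sup>2) + y\<^sup>2 * (1 - b * r)\<^sup>2 / (1 - r\<^sup>2) \<le> y\<^sup>2 * (1 - b\<^sup>2) + \<delta> / 2"
    using rate_exists[of b c y "\<delta> / 2"] b c \<delta> y by auto
  \<comment> \<open>The jump \<open>j\<close> across 0 is at most \<open>2 * r ^ n\<close>, so its
    square is at most \<open>4 * (\<delta> / 8)\<close>, one half of the allowance; the other half
    went into the choice of \<open>r\<close>.\<close>
  obtain n where n: "r ^ n < min 1 (\<delta> / 8)"
    using real_arch_pow_inv[of "min 1 (\<delta> / 8)" r] r \<delta> by auto
  have rn: "0 \<le> r ^ n" using r by simp
  obtain us where us: "\<forall>u\<in>set us. 0 \<le> u" "steer b c (- c) us = - c * r ^ n"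
    "(\<Sum>u\<leftarrow>us. u\<^sup>2) = c\<^sup>2 * (b - r)\<^sup>2 / (1 - r\<^sup>2) * (1 - r ^ (2 * n))"
    using steer_relax[of r b c n] r c by auto
  obtain vs where vs: "\<forall>u\<in>set vs. 0 \<le> u" "steer b c (y * r ^ n) vs = y"
    "(\<Sum>u\<leftarrow>vs. u\<^sup>2) = y\<^sup>2 * (1 - b * r)\<^sup>2 / (1 - r\<^sup>2) * (1 - r ^ (2 * n))"
    using steer_grow[of r b y c n] r b y by auto
  define j where "j = (y + b * c) * r ^ n"
  have bc: "b * c \<le> 1" "b * y \<le> 1" using b c y by (auto intro!: mult_le_one)
  have j0: "0 \<le> j" using b c y rn by (simp add: j_def)
  have "j \<le> 2 * r ^ n"
    unfolding j_def using bc y c rn by (intro mult_right_mono) auto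
  then have "j\<^sup>2 \<le> (2 * r ^ n)\<^sup>2" using j0 by (intro power_mono)
  also have "\<dots> = 4 * (r ^ n * r ^ n)" by (simp add: power2_eq_square)
  also have "\<dots> \<le> 4 * (1 * (\<delta> / 8))" using n rn by (intro mult_left_mono mult_mono) auto
  finally have j2: "j\<^sup>2 \<le> \<delta> / 2" by simp
  have "c * r ^ n \<le> c * 1" using n c by (intro mult_left_mono) auto
  then have sat1: "saturate b c (- c * r ^ n) = b * (- c * r ^ n)"
    using c rn by (intro saturate_eq) (auto simp: abs_mult)
  have jump: "b * (- c * r ^ n) + j = y * r ^ n" by (simp add: j_def algebra_simps)
  have sat2: "saturate b c y = b * y" using y by (intro saturate_eq) auto
  \<comment> \<open>The leading 0 lifts any start to at least \<open>- c\<close>; \<open>us\<close>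
    relaxes, \<open>j\<close> passes from just below 0 to the start of the growth phase
    \<open>vs\<close>, and the last entry carries \<open>y\<close> exactly to 1.\<close>
  define ws where "ws = 0 # us @ j # vs @ [1 - b * y]"
  show ?thesis
  proof (rule that[of ws])
    show "ws \<noteq> []" by (simp add: ws_def)
    show "0 \<le> u" if "u \<in> set ws" for u
      using that us vs j0 bc by (auto simp: ws_def)
    show "1 \<le> steer b c x ws" for x
    proof -
      have "1 = steer b c (- c) (us @ j # vs @ [1 - b * y])"
        by (simp only: steer_append steer_Cons us(2) sat1 jump vs(2) sat2 steer_Nil)
      also have "\<dots> \<le> steer b c (saturate b c x + 0) (us @ j # vs @ [1 - b * y])"
        using saturate_ge[of b c x] b c by (intro steer_mono) auto
      finally show ?thesis by (simp add: ws_def)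
    qed
    have r2: "0 \<le> r ^ (2 * n)" "0 < 1 - r\<^sup>2"
      using r by (auto simp: abs_square_less_1)
    have "(\<Sum>u\<leftarrow>us. u\<^sup>2) \<le> c\<^sup>2 * (b - r)\<^sup>2 / (1 - r\<^sup>2) * 1"
      "(\<Sum>u\<leftarrow>vs. u\<^sup>2) \<le> y\<^sup>2 * (1 - b * r)\<^sup>2 / (1 - r\<^sup>2) * 1"
      unfolding us(3) vs(3) using r2 by (intro mult_left_mono; simp)+
    then have "(\<Sum>u\<leftarrow>ws. u\<^sup>2) \<le> y\<^sup>2 * (1 - b\<^sup>2) + \<delta> / 2 + \<delta> / 2 + (1 - b * y)\<^sup>2"
      using cost j2 by (simp add: ws_def)
    also have "\<dots> = 1 - 2 * b * y + y\<^sup>2 + \<delta>"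
      by (simp add: power2_eq_square algebra_simps)
    finally show "(\<Sum>u\<leftarrow>ws. u\<^sup>2) \<le> 1 - 2 * b * y + y\<^sup>2 + \<delta>" .
  qed
qed

lemma saturate_uminus:
  assumes "0 \<le> c"
  shows "saturate b c (- x) = - saturate b c x"
proof -
  have "max (- c) (min c (- x)) = - max (- c) (min c x)"
    using assms by (auto simp: max_def min_def)
  then show ?thesis by (simp add: saturate_def)
qed

section \<open>Gaussian tails, independent blocks of noise and geometric tails\<close>

text \<open>The half-line contains a unit interval on which the density is at least its value at
  distance \<open>t + 1\<close> from 0. The shift by 1 is harmless on the exponential scale.\<close>

lemma (in prob_space) std_normal_tail_ge:
  assumes X: "distributed M lborel X std_normal_density"
    and \<sigma>: "\<sigma> = 1 \<or> \<sigma> = - 1" and t: "0 \<le> t"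
  shows "std_normal_density (t + 1) \<le> prob (X -` {z. t \<le> \<sigma> * z} \<inter> space M)"
proof -
  define I where "I = (if \<sigma> = 1 then {t..t + 1} else {- (t + 1)..- t})"
  have dens: "std_normal_density (t + 1) \<le> std_normal_density z" "t \<le> \<sigma> * z" if "z \<in> I" for z
  proof -
    have "\<bar>z\<bar> \<le> \<bar>t + 1\<bar>" using that \<sigma> t by (auto simp: I_def split: if_splits)
    then have "z\<^sup>2 \<le> (t + 1)\<^sup>2" by (simp only: abs_le_square_iff)
    then show "std_normal_density (t + 1) \<le> std_normal_density z"
      by (simp add: std_normal_density_def divide_right_mono)
    show "t \<le> \<sigma> * z" using that \<sigma> by (auto simp: I_def split: if_splits)
  qed
  have I: "emeasure lborel I = 1" "I \<in> sets lborel" by (auto simp: I_def)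
  have "ennreal (std_normal_density (t + 1)) =
      (\<integral>\<^sup>+z. ennreal (std_normal_density (t + 1)) * indicator I z \<partial>lborel)"
    using I by (simp add: nn_integral_cmult_indicator)
  also have "\<dots> \<le> (\<integral>\<^sup>+z. ennreal (std_normal_density z) * indicator {z. t \<le> \<sigma> * z} z \<partial>lborel)"
    using dens by (intro nn_integral_mono) (auto split: split_indicator intro!: ennreal_leI)
  also have "\<dots> = emeasure M (X -` {z. t \<le> \<sigma> * z} \<inter> space M)"
    by (rule distributed_emeasure[OF X, symmetric]) simp
  finally show ?thesis by (simp add: emeasure_eq_measure)
qed

text \<open>The \<open>Suc\<close> matches the recursion, where the step out of time
  \<open>n\<close> uses the noise with index \<open>Suc n\<close>: block \<open>i\<close> drives the
  orbit from time \<open>i * N\<close> to \<open>Suc i * N\<close>.\<close>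

definition block :: "nat \<Rightarrow> nat \<Rightarrow> nat set" where
  "block N i = (\<lambda>k. Suc (i * N + k)) ` {..<N}"

lemma disjoint_family_block: "disjoint_family_on (block N) L"
proof -
  have "i = i'" if "Suc (i * N + k) = Suc (i' * N + k')" "k < N" "k' < N" for i i' k k'
  proof -
    have "(i * N + k) div N = i" if "k < N" for i k
      using that by simp
    then show ?thesis using that by (metis nat.inject)
  qed
  then show ?thesis
    unfolding disjoint_family_on_def block_def by blast
qed

lemma prod_block:
  "(\<Prod>j\<in>block N i. h j) = (\<Prod>k<N. h (Suc (i * N + k)))"
proof -
  have "inj_on (\<lambda>k. Suc (i * N + k)) {..<N}" by (rule inj_onI) simp
  then show ?thesis by (simp add: block_def prod.reindex)
qed

text \<open>Families of variables over disjoint index blocks are independent of each other, so the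
  failure probabilities of the blocks, each at most \<open>1 - p\<close>, multiply.\<close>

lemma (in prob_space) prob_no_good_block:
  assumes ind: "indep_vars (\<lambda>_. borel) \<xi> {1..}" and A: "\<And>j. A j \<in> sets borel"
    and N: "0 < N"
    and p: "\<And>i. p \<le> (\<Prod>j\<in>block N i. prob (\<xi> j -` A j \<inter> space M))"
  defines "E \<equiv> \<lambda>m. {\<omega> \<in> space M. \<forall>i<m. \<exists>j\<in>block N i. \<xi> j \<omega> \<notin> A j}"
  shows "E m \<in> events" "prob (E m) \<le> (1 - p) ^ m"
proof -
  have meas [measurable]: "\<xi> j \<in> borel_measurable M" if "1 \<le> j" for j
    using ind that by (auto simp: indep_vars_def)
  have ge1: "1 \<le> j" if "j \<in> block N i" for i j using that by (auto simp: block_def)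
  have fin: "finite (block N i)" "block N i \<noteq> {}" for i
    using N by (auto simp: block_def)
  define G where "G i = (\<Inter>j\<in>block N i. \<xi> j -` A j \<inter> space M)" for i
  have G: "G i \<in> events" for i
    unfolding G_def using fin A meas ge1 by (intro sets.finite_INT) (auto intro!: measurable_sets)
  have G_iff: "\<omega> \<in> G i \<longleftrightarrow> \<omega> \<in> space M \<and> (\<forall>j\<in>block N i. \<xi> j \<omega> \<in> A j)" for \<omega> i
    using fin(2)[of i] unfolding G_def by blast
  then have E: "E m = space M - (\<Union>i<m. G i)"
    by (auto simp: E_def)
  then show "E m \<in> events" using G by auto
  have prob_G: "prob (G i) = (\<Prod>j\<in>block N i. prob (\<xi> j -` A j \<inter> space M))" for i
    unfolding G_def by (rule indep_varsD[OF ind]) (use fin A ge1 in auto)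
  show "prob (E m) \<le> (1 - p) ^ m"
  \<comment> \<open>For \<open>m = 0\<close> the intersection below would be the whole type instead
    of \<open>space M\<close>.\<close>
  proof (cases "m = 0")
    case True
    then show ?thesis by simp
  next
    case False
    \<comment> \<open>\<open>Z i\<close> is the noise of a block as one random vector, and
      \<open>S i\<close> is the set of its values that miss the target box.\<close>
    define Z where "Z i \<omega> = restrict (\<lambda>j. \<xi> j \<omega>) (block N i)" for i \<omega>
    define S where "S i = space (PiM (block N i) (\<lambda>_. borel)) - Pi\<^sub>E (block N i) A" for i
    have indZ: "indep_vars (\<lambda>i. PiM (block N i) (\<lambda>_. borel)) Z {..<m}"
      unfolding Z_def
      by (rule indep_vars_restrict[OF ind]) (use ge1 disjoint_family_block in auto)
    have S: "S i \<in> sets (PiM (block N i) (\<lambda>_. borel))" for i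
      unfolding S_def using fin A by (intro sets.Diff sets.top sets_PiM_I_finite) auto
    have ZS: "Z i -` S i \<inter> space M = space M - G i" for i
      unfolding Z_def S_def by (auto simp: G_iff restrict_PiE_iff space_PiM)
    have "E m = (\<Inter>i<m. Z i -` S i \<inter> space M)"
      unfolding E ZS using False by auto
    also have "prob \<dots> = (\<Prod>i<m. prob (Z i -` S i \<inter> space M))"
      by (rule indep_varsD[OF indZ]) (use S False in auto)
    also have "\<dots> \<le> (\<Prod>i<m. 1 - p)"
      using p by (intro prod_mono) (auto simp: ZS prob_compl G prob_G[symmetric])
    finally show ?thesis by simp
  qed
qed

text \<open>Pointwise, \<open>T\<close> is at most \<open>N\<close> times the number of
  \<open>m\<close> with \<open>m * N < T\<close>. Integrating the indicators of \<open>E m\<close>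
  leaves \<open>N\<close> times a geometric series with sum \<open>1 / p\<close>.\<close>

lemma (in prob_space) nn_integral_le_of_geometric_tail:
  fixes T :: "'a \<Rightarrow> enat"
  assumes E: "\<And>m. E m \<in> events" "\<And>m. prob (E m) \<le> (1 - p) ^ m" and p: "0 < p" "p \<le> 1"
    and N: "0 < N"
    and T: "\<And>m \<omega>. \<omega> \<in> space M \<Longrightarrow> enat (m * N) < T \<omega> \<Longrightarrow> \<omega> \<in> E m"
  shows "(\<integral>\<^sup>+\<omega>. ennreal_of_enat (T \<omega>) \<partial>M) \<le> ennreal (N / p)"
proof -
  define R where "R \<omega> = (\<Sum>m. of_nat N * indicator (E m) \<omega> :: ennreal)" for \<omega>
  have R: "of_nat n \<le> R \<omega>" if \<omega>: "\<omega> \<in> space M" and n: "enat n \<le> T \<omega>" for n \<omega>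
  proof -
    \<comment> \<open>\<open>K\<close> is \<open>n / N\<close> rounded up, so that
      \<open>m * N < n\<close> for all \<open>m < K\<close> and yet
      \<open>n \<le> K * N\<close>.\<close>
    define K where "K = (n + (N - 1)) div N"
    have "m * N < n" if "m < K" for m
    proof -
      have "Suc m * N \<le> K * N" using that by (intro mult_right_mono) auto
      also have "\<dots> \<le> n + (N - 1)" by (simp add: K_def)
      finally show ?thesis using N by simp
    qed
    then have "\<omega> \<in> E m" if "m < K" for m
      using T[OF \<omega>, of m] n that by (meson enat_ord_simps(2) order_less_le_trans)
    then have "of_nat (K * N) = (\<Sum>m<K. of_nat N * indicator (E m) \<omega> :: ennreal)"
      by simp
    also have "\<dots> \<le> R \<omega>" unfolding R_def by (rule sum_le_suminf) auto
    finally have "of_nat (K * N) \<le> R \<omega>" .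
    moreover have "n \<le> K * N"
    proof -
      have "n + (N - 1) < K * N + N"
        unfolding K_def using dividend_less_div_times[OF N] by (simp only: add.commute)
      then show ?thesis using N by simp
    qed
    ultimately show ?thesis by (meson of_nat_mono order_trans)
  qed
  have "ennreal_of_enat (T \<omega>) \<le> R \<omega>" if \<omega>: "\<omega> \<in> space M" for \<omega>
  proof (cases "T \<omega>")
    case (enat n)
    then show ?thesis using R[OF \<omega>, of n] by simp
  next
    case infinity
    then have "of_nat n \<le> R \<omega>" for n using R[OF \<omega>] by simp
    then have "R \<omega> = top"
      by (metis ennreal_Ex_less_of_nat not_le top.not_eq_extremum)
    then show ?thesis by simp
  qed
  then have "(\<integral>\<^sup>+\<omega>. ennreal_of_enat (T \<omega>) \<partial>M) \<le> (\<integral>\<^sup>+\<omega>. R \<omega> \<partial>M)"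
    by (rule nn_integral_mono)
  also have "\<dots> = (\<Sum>m. of_nat N * emeasure M (E m))"
    unfolding R_def using E by (subst nn_integral_suminf) (auto simp: nn_integral_cmult_indicator)
  also have "\<dots> \<le> (\<Sum>m. ennreal (N * (1 - p) ^ m))"
    using E by (intro suminf_le)
      (auto simp: emeasure_eq_measure ennreal_mult' ennreal_of_nat_eq_real_of_nat intro!: mult_left_mono ennreal_leI)
  also have "\<dots> = ennreal (N / p)"
  proof (rule suminf_ennreal_eq)
    show "(\<lambda>m. N * (1 - p) ^ m) sums (N / p)"
      using sums_mult[OF geometric_sums[of "1 - p"], of N] p by simp
  qed (use p in auto)
  finally show ?thesis .
qed

section \<open>Comparison of the orbit with the control, and the bound on the mean exit time\<close>

text \<open>Multiplying the orbit by \<open>\<sigma>\<^sup>n\<close> turns slope \<open>a\<close> into slope \<open>\<sigma> * a\<close>, so that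
  a negative \<open>a\<close> is reduced to the monotone case by \<open>\<sigma> = - 1\<close>.\<close>
lemma orbit_ge_steer:
  assumes f: "\<And>x. \<bar>x\<bar> < 1 \<Longrightarrow> f x = saturate a c x" and c: "0 \<le> c"
    and \<sigma>: "\<sigma> = 1 \<or> \<sigma> = - 1" and b: "0 \<le> \<sigma> * a"
    and noise: "\<And>k. k < length us \<Longrightarrow> us ! k \<le> \<epsilon> * (\<sigma> ^ Suc (j + k) * \<xi> (Suc (j + k)) \<omega>)"
    and inside: "\<And>k. k < length us \<Longrightarrow> \<bar>perturbed_orbit f \<xi> \<epsilon> (j + k) \<omega>\<bar> < 1"
    and k: "k \<le> length us"
  shows "steer (\<sigma> * a) c (\<sigma> ^ j * perturbed_orbit f \<xi> \<epsilon> j \<omega>) (take k us)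
           \<le> \<sigma> ^ (j + k) * perturbed_orbit f \<xi> \<epsilon> (j + k) \<omega>"
  using k
proof (induction k)
  case 0
  show ?case by simp
next
  case (Suc k)
  let ?X = "\<lambda>n. perturbed_orbit f \<xi> \<epsilon> n \<omega>"
  have k: "k < length us" using Suc by simp
  have "\<sigma> ^ n = 1 \<or> \<sigma> ^ n = - 1" for n using \<sigma> by (induction n) auto
  \<comment> \<open>Since \<open>saturate\<close> is odd in its argument,
    \<open>\<sigma> ^ (j + k)\<close> moves inside, while the remaining factor
    \<open>\<sigma>\<close> joins the slope.\<close>
  from this[of "j + k"] have flip: "\<sigma> ^ Suc (j + k) * saturate a c x = saturate (\<sigma> * a) c (\<sigma> ^ (j + k) * x)" for x
    using c by (auto simp: saturate_uminus) (simp_all add: saturate_def)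
  have "steer (\<sigma> * a) c (\<sigma> ^ j * ?X j) (take (Suc k) us)
      = saturate (\<sigma> * a) c (steer (\<sigma> * a) c (\<sigma> ^ j * ?X j) (take k us)) + us ! k"
    using k by (simp add: take_Suc_conv_app_nth)
  also have "\<dots> \<le> saturate (\<sigma> * a) c (\<sigma> ^ (j + k) * ?X (j + k)) + \<epsilon> * (\<sigma> ^ Suc (j + k) * \<xi> (Suc (j + k)) \<omega>)"
    using Suc.IH k noise[OF k] b by (intro add_mono saturate_mono) auto
  also have "\<dots> = \<sigma> ^ (j + Suc k) * ?X (j + Suc k)"
    using f[OF inside[OF k]] flip[of "?X (j + k)"] by (simp add: algebra_simps)
  finally show ?case .
qed

lemma orbit_inside:
  assumes "enat t < exit_time f \<xi> \<epsilon> \<omega>" "n \<le> t"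
  shows "\<bar>perturbed_orbit f \<xi> \<epsilon> n \<omega>\<bar> < 1"
proof (rule ccontr)
  assume *: "\<not> ?thesis"
  \<comment> \<open>Exit is only counted from time 1 on; time 0 is settled by the start at
    0.\<close>
  then have "n \<noteq> 0" by (intro notI) simp
  with * have "exit_time f \<xi> \<epsilon> \<omega> \<le> enat n"
    unfolding exit_time_def by (intro Inf_lower) auto
  with assms show False by (meson enat_ord_simps(1) leD order_trans)
qed

lemma (in prob_space) expected_exit_time_le:
  assumes ind: "indep_vars (\<lambda>_. borel) \<xi> {1..}"
    and nd: "\<And>n. 1 \<le> n \<Longrightarrow> distributed M lborel (\<xi> n) std_normal_density"
    and f: "\<And>x. \<bar>x\<bar> < 1 \<Longrightarrow> f x = saturate a c x" and c: "0 \<le> c"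
    and \<sigma>: "\<sigma> = 1 \<or> \<sigma> = - 1" and b: "0 \<le> \<sigma> * a"
    and us: "us \<noteq> []" "\<And>u. u \<in> set us \<Longrightarrow> 0 \<le> u" "\<And>x. 1 \<le> steer (\<sigma> * a) c x us"
    and \<epsilon>: "0 < \<epsilon>"
  shows "expected_exit_time M f \<xi> \<epsilon>
     \<le> ennreal (length us / (\<Prod>k<length us. std_normal_density (us ! k / \<epsilon> + 1)))"
proof -
  define N where "N = length us"
  \<comment> \<open>With \<open>j = Suc (i * N + k)\<close>, the term \<open>(j - 1) mod N\<close>
    recovers the position \<open>k\<close> in the block, and \<open>\<sigma> ^ j\<close> selects the
    side on which the noise must be large.\<close>
  define A where "A j = {z. us ! ((j - 1) mod N) / \<epsilon> \<le> \<sigma> ^ j * z}" for j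
  define p where "p = (\<Prod>k<N. std_normal_density (us ! k / \<epsilon> + 1))"
  define E where "E m = {\<omega> \<in> space M. \<forall>i<m. \<exists>j\<in>block N i. \<xi> j \<omega> \<notin> A j}" for m
  have N: "0 < N" using us by (simp add: N_def)
  have A: "A j \<in> sets borel" for j by (simp add: A_def)
  have sgn: "\<sigma> ^ n = 1 \<or> \<sigma> ^ n = - 1" for n using \<sigma> by (induction n) auto
  have nonneg: "0 \<le> us ! k / \<epsilon>" if "k < N" for k
    using us(2)[of "us ! k"] \<epsilon> that by (simp add: N_def)
  have p_le: "p \<le> (\<Prod>j\<in>block N i. prob (\<xi> j -` A j \<inter> space M))" for i
    unfolding p_def prod_block
  proof (rule prod_mono, safe)
    fix k assume k: "k < N"
    show "std_normal_density (us ! k / \<epsilon> + 1)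
        \<le> prob (\<xi> (Suc (i * N + k)) -` A (Suc (i * N + k)) \<inter> space M)"
      using std_normal_tail_ge[OF nd[of "Suc (i * N + k)"] sgn[of "Suc (i * N + k)"] nonneg[OF k]] k
      by (simp add: A_def)
  qed auto
  have p0: "0 < p" unfolding p_def by (intro prod_pos) (auto intro: normal_density_pos)
  have "p \<le> (\<Prod>j\<in>block N 0. 1)"
    using p_le[of 0] by (rule order_trans) (intro prod_mono, auto)
  then have p1: "p \<le> 1" by simp
  have "expected_exit_time M f \<xi> \<epsilon> \<le> ennreal (N / p)"
    unfolding expected_exit_time_def
  proof (rule nn_integral_le_of_geometric_tail[OF _ _ p0 p1 N])
    show "E m \<in> events" "prob (E m) \<le> (1 - p) ^ m" for m
      unfolding E_def by (rule prob_no_good_block[OF ind A N p_le])+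
    show "\<omega> \<in> E m" if \<omega>: "\<omega> \<in> space M" and T: "enat (m * N) < exit_time f \<xi> \<epsilon> \<omega>" for m \<omega>
    proof (rule ccontr)
      assume "\<omega> \<notin> E m"
      then obtain i where i: "i < m" "\<And>j. j \<in> block N i \<Longrightarrow> \<xi> j \<omega> \<in> A j"
        using \<omega> by (auto simp: E_def)
      have "Suc i * N \<le> m * N" using i by (intro mult_right_mono) auto
      \<comment> \<open>The end \<open>k = N\<close> is included: a good block pushes the orbit out
        at precisely that time, which yields the contradiction.\<close>
      then have inside: "\<bar>perturbed_orbit f \<xi> \<epsilon> (i * N + k) \<omega>\<bar> < 1" if "k \<le> N" for k
        using that by (intro orbit_inside[OF T]) simp
      have noise: "us ! k \<le> \<epsilon> * (\<sigma> ^ Suc (i * N + k) * \<xi> (Suc (i * N + k)) \<omega>)" if "k < N" for k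
      proof -
        have "\<xi> (Suc (i * N + k)) \<omega> \<in> A (Suc (i * N + k))"
          using that by (intro i) (auto simp: block_def)
        then show ?thesis using that \<epsilon> by (simp add: A_def field_simps)
      qed
      have "1 \<le> steer (\<sigma> * a) c (\<sigma> ^ (i * N) * perturbed_orbit f \<xi> \<epsilon> (i * N) \<omega>) (take N us)"
        using us(3) by (simp add: N_def)
      also have "\<dots> \<le> \<sigma> ^ (i * N + N) * perturbed_orbit f \<xi> \<epsilon> (i * N + N) \<omega>"
        by (rule orbit_ge_steer[OF f c \<sigma> b])
          (simp_all only: N_def[symmetric] noise inside less_imp_le order_refl)
      also have "\<dots> \<le> \<bar>perturbed_orbit f \<xi> \<epsilon> (i * N + N) \<omega>\<bar>"
        using sgn[of "i * N + N"] by auto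
      finally show False using inside[of N] by simp
    qed
  qed
  then show ?thesis by (simp add: N_def p_def)
qed

section \<open>Logarithmic asymptotics and the choice of the level\<close>

lemma ext_ln_le:
  assumes "x \<le> ennreal K" "0 < K"
  shows "ext_ln x \<le> ereal (ln K)"
proof (cases "x = 0")
  case False
  with assms obtain r where r: "x = ennreal r" "0 < r" "r \<le> K"
    by (cases x) (auto simp: ennreal_le_iff2 top_unique)
  then show ?thesis by (simp add: ext_ln_def)
qed (simp add: ext_ln_def)

text \<open>The control depends on \<open>\<delta>\<close> but not on \<open>\<epsilon>\<close>, so
  its length is a constant that \<open>\<epsilon>\<^sup>2\<close> removes in the limit;
  \<open>\<delta>\<close> goes to 0 afterwards.\<close>

lemma (in prob_space) Limsup_exit_time_le:
  assumes ind: "indep_vars (\<lambda>_. borel) \<xi> {1..}"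
    and nd: "\<And>n. 1 \<le> n \<Longrightarrow> distributed M lborel (\<xi> n) std_normal_density"
    and f: "\<And>x. \<bar>x\<bar> < 1 \<Longrightarrow> f x = saturate a c x" and c: "0 < c" "c \<le> 1"
    and a: "\<bar>a\<bar> \<le> 1" and y: "0 \<le> y" "y \<le> c"
  shows "Limsup (at_right 0) (\<lambda>\<epsilon>. ereal (\<epsilon>\<^sup>2) * ext_ln (expected_exit_time M f \<xi> \<epsilon>))
           \<le> ereal ((1 - 2 * \<bar>a\<bar> * y + y\<^sup>2) / 2)"
proof (rule ereal_le_epsilon2)
  fix \<delta> :: real assume \<delta>: "0 < \<delta>"
  define \<sigma> :: real where "\<sigma> = (if a < 0 then - 1 else 1)"
  have \<sigma>: "\<sigma> = 1 \<or> \<sigma> = - 1" "\<sigma> * a = \<bar>a\<bar>" by (auto simp: \<sigma>_def)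
  obtain us where us: "us \<noteq> []" "\<And>u. u \<in> set us \<Longrightarrow> 0 \<le> u" "\<And>x. 1 \<le> steer \<bar>a\<bar> c x us"
    "(\<Sum>u\<leftarrow>us. u\<^sup>2) \<le> 1 - 2 * \<bar>a\<bar> * y + y\<^sup>2 + \<delta>"
    using control_exists[of "\<bar>a\<bar>" c \<delta> y] a c y \<delta> by auto
  define N where "N = length us"
  \<comment> \<open>For \<open>\<epsilon> > 0\<close> this is exactly
    \<open>\<epsilon>\<^sup>2\<close> times the logarithm of the bound on the mean exit time; it is
    a polynomial in \<open>\<epsilon>\<close>, so its limit is its value at 0.\<close>
  define h where "h \<epsilon> = \<epsilon>\<^sup>2 * (ln N + N * ln (sqrt (2 * pi))) + (\<Sum>k<N. (us ! k + \<epsilon>)\<^sup>2) / 2" for \<epsilon>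
  have N: "0 < N" using us by (simp add: N_def)
  have "ereal (\<epsilon>\<^sup>2) * ext_ln (expected_exit_time M f \<xi> \<epsilon>) \<le> ereal (h \<epsilon>)" if \<epsilon>: "0 < \<epsilon>" for \<epsilon>
  proof -
    let ?p = "\<Prod>k<N. std_normal_density (us ! k / \<epsilon> + 1)"
    have p0: "0 < ?p" by (intro prod_pos) (auto intro: normal_density_pos)
    have "expected_exit_time M f \<xi> \<epsilon> \<le> ennreal (N / ?p)"
      unfolding N_def
      by (rule expected_exit_time_le[OF ind nd f _ \<sigma>(1)]; (unfold \<sigma>(2))?) (use us c \<epsilon> in blast | use c in simp)+
    then have le: "ext_ln (expected_exit_time M f \<xi> \<epsilon>) \<le> ereal (ln (N / ?p))"
      using p0 N by (intro ext_ln_le) auto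
    have nz: "std_normal_density t \<noteq> 0" for t
      using normal_density_pos[of 1 0 t] by simp
    have "ln (std_normal_density t) = - ln (sqrt (2 * pi)) - t\<^sup>2 / 2" for t
      by (simp add: std_normal_density_def ln_mult ln_div)
    then have "ln ?p = (\<Sum>k<N. - ln (sqrt (2 * pi)) - (us ! k / \<epsilon> + 1)\<^sup>2 / 2)"
      by (subst ln_prod) (auto simp: nz)
    then have "ln (N / ?p) = ln N + N * ln (sqrt (2 * pi)) + (\<Sum>k<N. (us ! k / \<epsilon> + 1)\<^sup>2) / 2"
      using p0 N by (simp add: ln_div sum_subtractf sum_divide_distrib sum_negf nz)
    moreover have "\<epsilon>\<^sup>2 * (us ! k / \<epsilon> + 1)\<^sup>2 = (us ! k + \<epsilon>)\<^sup>2" for k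
      using \<epsilon> by (simp add: power_mult_distrib[symmetric] field_simps)
    ultimately have "\<epsilon>\<^sup>2 * ln (N / ?p) = h \<epsilon>"
      by (simp add: h_def distrib_left sum_distrib_left)
    moreover have "ereal (\<epsilon>\<^sup>2) * ext_ln (expected_exit_time M f \<xi> \<epsilon>) \<le> ereal (\<epsilon>\<^sup>2) * ereal (ln (N / ?p))"
      using le by (intro ereal_mult_left_mono) auto
    ultimately show ?thesis by simp
  qed
  then have "Limsup (at_right 0) (\<lambda>\<epsilon>. ereal (\<epsilon>\<^sup>2) * ext_ln (expected_exit_time M f \<xi> \<epsilon>))
      \<le> Limsup (at_right 0) (\<lambda>\<epsilon>. ereal (h \<epsilon>))"
    by (intro Limsup_mono eventually_mono[OF eventually_at_right_less])
  also have "\<dots> = ereal ((\<Sum>k<N. (us ! k)\<^sup>2) / 2)"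
  proof (intro lim_imp_Limsup tendsto_ereal)
    have "(h \<longlongrightarrow> 0\<^sup>2 * (ln N + N * ln (sqrt (2 * pi))) + (\<Sum>k<N. (us ! k + 0)\<^sup>2) / 2) (at_right 0)"
      unfolding h_def by (intro tendsto_intros) auto
    then show "(h \<longlongrightarrow> (\<Sum>k<N. (us ! k)\<^sup>2) / 2) (at_right 0)" by simp
  qed simp
  also have "(\<Sum>k<N. (us ! k)\<^sup>2) = (\<Sum>u\<leftarrow>us. u\<^sup>2)"
    by (simp add: sum_list_sum_nth N_def atLeast0LessThan)
  also have "ereal ((\<Sum>u\<leftarrow>us. u\<^sup>2) / 2) \<le> ereal ((1 - 2 * \<bar>a\<bar> * y + y\<^sup>2) / 2) + ereal \<delta>"
    using us(4) \<delta> by (simp add: add_divide_distrib diff_divide_distrib)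
  finally show "Limsup (at_right 0) (\<lambda>\<epsilon>. ereal (\<epsilon>\<^sup>2) * ext_ln (expected_exit_time M f \<xi> \<epsilon>))
      \<le> ereal ((1 - 2 * \<bar>a\<bar> * y + y\<^sup>2) / 2) + ereal \<delta>" .
qed

theorem mainTheorem5:
  fixes M :: "'a measure" and \<xi> :: "nat \<Rightarrow> 'a \<Rightarrow> real"
    and f :: "real \<Rightarrow> real" and a c :: real
  assumes "prob_space M"
    and "prob_space.indep_vars M (\<lambda>_. borel) \<xi> {1..}"
    and "\<And>n. n \<ge> 1 \<Longrightarrow> distributed M lborel (\<xi> n) std_normal_density"
    and "0 < c" and "c \<le> 1"
    and "- c \<le> a" and "a \<le> 1"
    and "continuous_on UNIV f"
    and "\<And>x. - 1 \<le> x \<Longrightarrow> x < - c \<Longrightarrow> f x = - (a * c)"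
    and "\<And>x. - c \<le> x \<Longrightarrow> x \<le> c \<Longrightarrow> f x = a * x"
    and "\<And>x. c < x \<Longrightarrow> x \<le> 1 \<Longrightarrow> f x = a * c"
  shows "(c \<le> a \<longrightarrow>
           Limsup (at_right 0) (\<lambda>\<epsilon>. ereal (\<epsilon>\<^sup>2) * ext_ln (expected_exit_time M f \<xi> \<epsilon>))
             \<le> ereal (1 / 2 * ((1 - a * c)\<^sup>2 + (1 - a\<^sup>2) * c\<^sup>2)))
       \<and> (a \<le> c \<longrightarrow>
           Limsup (at_right 0) (\<lambda>\<epsilon>. ereal (\<epsilon>\<^sup>2) * ext_ln (expected_exit_time M f \<xi> \<epsilon>))
             \<le> ereal (1 / 2 * (1 - a\<^sup>2)))"
proof -
  interpret prob_space M by fact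
  have f: "f x = saturate a c x" if "\<bar>x\<bar> < 1" for x
    using assms(4) assms(9)[of x] assms(10)[of x] assms(11)[of x] that
    by (cases "x < - c"; cases "c < x") (auto simp: saturate_def)
  have a: "\<bar>a\<bar> \<le> 1" using assms(5-7) by auto
  note bound = Limsup_exit_time_le[OF assms(2,3) f assms(4,5) a]
  show ?thesis
  proof (intro conjI impI)
    assume "c \<le> a"
    \<comment> \<open>The quadratic in the level decreases up to \<open>\<bar>a\<bar> = a\<close>,
      which is at least \<open>c\<close>, so \<open>c\<close> is the best admissible level.\<close>
    then have cost: "(1 - 2 * \<bar>a\<bar> * c + c\<^sup>2) / 2 = 1 / 2 * ((1 - a * c)\<^sup>2 + (1 - a\<^sup>2) * c\<^sup>2)"
      using assms(4) by (simp add: power2_eq_square field_simps)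
    show "Limsup (at_right 0) (\<lambda>\<epsilon>. ereal (\<epsilon>\<^sup>2) * ext_ln (expected_exit_time M f \<xi> \<epsilon>))
        \<le> ereal (1 / 2 * ((1 - a * c)\<^sup>2 + (1 - a\<^sup>2) * c\<^sup>2))"
      using bound[of c] assms(4) unfolding cost by simp
  next
    assume "a \<le> c"
    \<comment> \<open>Here the minimiser \<open>\<bar>a\<bar>\<close> of the quadratic is itself
      admissible; for negative \<open>a\<close> this rests on \<open>- c \<le> a\<close>.\<close>
    then have abs: "0 \<le> \<bar>a\<bar>" "\<bar>a\<bar> \<le> c" using assms(6) by auto
    have cost: "(1 - 2 * \<bar>a\<bar> * \<bar>a\<bar> + \<bar>a\<bar>\<^sup>2) / 2 = 1 / 2 * (1 - a\<^sup>2)"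
      by (simp add: power2_eq_square)
    show "Limsup (at_right 0) (\<lambda>\<epsilon>. ereal (\<epsilon>\<^sup>2) * ext_ln (expected_exit_time M f \<xi> \<epsilon>))
        \<le> ereal (1 / 2 * (1 - a\<^sup>2))"
      using bound[OF _ _ abs] unfolding cost by simp
  qed
qed

end
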